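(* Let $\mathbb{S}=(S,\mathrm{CON},\Vdash)$ be a simplified continuous information system. Define $\mathcal{F}(\mathbb{S})=(A,(\widehat{\mathrm{Con}}_X)_{X\in A},(\Vdash^{\mathcal F}_X)_{X\in A})$ by $A=\mathrm{CON}$, $\widehat{\mathrm{Con}}_X=\{\mathfrak{X}\subseteq A \text{ finite} : \mathfrak{X}=\{X\} \text{ or } (\forall Y\in\mathfrak{X})\, X\Vdash Y\}$ for $X\in\mathrm{CON}$, and, for $X\in\mathrm{CON}$, $\mathfrak{X}\in\widehat{\mathrm{Con}}_X$ and $Y\in\mathrm{CON}$: $\mathfrak{X}\Vdash^{\mathcal F}_X Y$ iff there is $E\in\mathfrak{X}\cup\{X\}$ with $E\Vdash Y$. Then $\mathcal{F}(\mathbb{S})$ is a strong continuous information frame.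
   Context: A simplified continuous information system is a triple $(S,\mathrm{CON},\Vdash)$ with $S$ a set, $\mathrm{CON}$ a collection of finite subsets of $S$ and $\Vdash\subseteq\mathrm{CON}\times S$, such that for all $X,Y\in\mathrm{CON}$, $a\in S$ and finite $F\subseteq S$ (writing $X\Vdash Y$ iff $X\Vdash b$ for all $b\in Y$): (1) $\{a\}\in\mathrm{CON}$; (2) if $X\subseteq Y$ and $X\Vdash a$ then $Y\Vdash a$; (3) if $X\Vdash Y$ and $Y\Vdash a$ then $X\Vdash a$; (4) if $X\Vdash a$ then there is $Z\in\mathrm{CON}$ with $X\Vdash Z$ and $Z\Vdash a$; (5) if $X\Vdash F$ then there is $Z\in\mathrm{CON}$ with $F\subseteq Z$ and $X\Vdash Z$. A continuous information frame is a triple $\mathbb{A}=(A,(\mathrm{Con}_i)_{i\in A},(\vDash_i)_{i\in A})$ where $A$ is a set, each $\mathrm{Con}_i$ is a set of finite subsets of $A$, and $\vDash_i\subseteq\mathrm{Con}_i\times A$; write $iRj$ iff $\{i\}\in\mathrm{Con}_j$, and for finite $Y$, $X\vDash_i Y$ iff $X\vDash_i b$ for all $b\in Y$. Required, for all $i,j,a\in A$ and finite $X,Y\subseteq A$: (i) $\{i\}\in\mathrm{Con}_i$; (ii) if $Y\subseteq X\in\mathrm{Con}_i$ then $Y\in\mathrm{Con}_i$; (iii) if $X\in\mathrm{Con}_i$ and $X\vDash_i Y$ then $Y\in\mathrm{Con}_i$; (iv) if $X,Y\in\mathrm{Con}_i$, $X\subseteq Y$ and $X\vDash_i a$ then $Y\vDash_i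 a$; (v) if $X\in\mathrm{Con}_i$, $X\vDash_i Y$ and $Y\vDash_i a$ then $X\vDash_i a$; (vi) if $iRj$ then $\mathrm{Con}_i\subseteq\mathrm{Con}_j$; (vii) if $iRj$, $X\in\mathrm{Con}_i$ and $X\vDash_i a$ then $X\vDash_j a$; (viii) if $X\vDash_i Y$ then there exist $e\in A$ and $Z\in\mathrm{Con}_e$ with $X\vDash_i \{e\}\cup Z$ and $Z\vDash_e Y$. The frame is strong if for all $i\in A$ and $X\in\mathrm{Con}_i$ with $X\neq\{i\}$ we have $\{i\}\vDash_i X$. *)

theory Defs
  imports Main
begin

definition entails_set :: "('a set \<Rightarrow> 'a \<Rightarrow> bool) \<Rightarrow> 'a set \<Rightarrow> 'a set \<Rightarrow> bool"
  where "entails_set ent X Y \<longleftrightarrow> (\<forall>b\<in>Y. ent X b)"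

locale simplified_continuous_information_system =
  fixes S :: "'a set"
    and CON :: "'a set set"
    and ent :: "'a set \<Rightarrow> 'a \<Rightarrow> bool"
  assumes CON_finite: "X \<in> CON \<Longrightarrow> finite X \<and> X \<subseteq> S"
    and ent_dom: "ent X a \<Longrightarrow> X \<in> CON \<and> a \<in> S"
    and singleton_CON: "a \<in> S \<Longrightarrow> {a} \<in> CON"
    and ent_mono: "\<lbrakk>X \<in> CON; Y \<in> CON; X \<subseteq> Y; ent X a\<rbrakk> \<Longrightarrow> ent Y a"
    and ent_cut: "\<lbrakk>X \<in> CON; Y \<in> CON; entails_set ent X Y; ent Y a\<rbrakk> \<Longrightarrow> ent X a"
    and ent_interpolate: "\<lbrakk>X \<in> CON; ent X a\<rbrakk> \<Longrightarrow> \<exists>Z\<in>CON. entails_set ent X Z \<and> ent Z a"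
    and ent_extend: "\<lbrakk>X \<in> CON; finite F; F \<subseteq> S; entails_set ent X F\<rbrakk>
          \<Longrightarrow> \<exists>Z\<in>CON. F \<subseteq> Z \<and> entails_set ent X Z"

definition frame_rel :: "('b \<Rightarrow> 'b set set) \<Rightarrow> 'b \<Rightarrow> 'b \<Rightarrow> bool"
  where "frame_rel Con i j \<longleftrightarrow> {i} \<in> Con j"

text \<open>The families \<open>Con\<close> and \<open>ent\<close> are total functions, constrained only at indices in \<open>A\<close>.
  Each \<open>ent i\<close> is a relation from \<open>Con i\<close>, so its extension to sets is asserted only of left-hand
  sides in \<open>Con i\<close>. This matters for \<open>Y = {}\<close>, where \<open>entails_set\<close> holds vacuously: hence
  the explicit premise \<open>X \<in> Con i\<close> in \<open>interpolation\<close>.\<close>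

locale continuous_information_frame =
  fixes A :: "'b set"
    and Con :: "'b \<Rightarrow> 'b set set"
    and ent :: "'b \<Rightarrow> 'b set \<Rightarrow> 'b \<Rightarrow> bool"
  assumes Con_finite: "\<lbrakk>i \<in> A; X \<in> Con i\<rbrakk> \<Longrightarrow> finite X \<and> X \<subseteq> A"
    and ent_dom: "\<lbrakk>i \<in> A; ent i X a\<rbrakk> \<Longrightarrow> X \<in> Con i \<and> a \<in> A"
    and self_Con: "i \<in> A \<Longrightarrow> {i} \<in> Con i"
    and Con_subset: "\<lbrakk>i \<in> A; X \<in> Con i; Y \<subseteq> X\<rbrakk> \<Longrightarrow> Y \<in> Con i"
    and Con_entailed: "\<lbrakk>i \<in> A; X \<in> Con i; finite Y; Y \<subseteq> A; entails_set (ent i) X Y\<rbrakk> \<Longrightarrow> Y \<in> Con i"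
    and ent_mono: "\<lbrakk>i \<in> A; a \<in> A; X \<in> Con i; Y \<in> Con i; X \<subseteq> Y; ent i X a\<rbrakk> \<Longrightarrow> ent i Y a"
    and ent_cut: "\<lbrakk>i \<in> A; a \<in> A; X \<in> Con i; finite Y; Y \<subseteq> A; entails_set (ent i) X Y; ent i Y a\<rbrakk>
          \<Longrightarrow> ent i X a"
    and Con_transfer: "\<lbrakk>i \<in> A; j \<in> A; frame_rel Con i j\<rbrakk> \<Longrightarrow> Con i \<subseteq> Con j"
    and ent_transfer: "\<lbrakk>i \<in> A; j \<in> A; a \<in> A; frame_rel Con i j; X \<in> Con i; ent i X a\<rbrakk> \<Longrightarrow> ent j X a"
    and interpolation: "\<lbrakk>i \<in> A; X \<in> Con i; finite Y; Y \<subseteq> A; entails_set (ent i) X Y\<rbrakk>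
          \<Longrightarrow> \<exists>e\<in>A. \<exists>Z\<in>Con e. entails_set (ent i) X ({e} \<union> Z) \<and> entails_set (ent e) Z Y"

locale strong_continuous_information_frame = continuous_information_frame +
  assumes strong: "\<lbrakk>i \<in> A; X \<in> Con i; X \<noteq> {i}\<rbrakk> \<Longrightarrow> entails_set (ent i) {i} X"

definition F_tokens :: "'a set set \<Rightarrow> 'a set set"
  where "F_tokens CON = CON"

definition F_Con :: "'a set set \<Rightarrow> ('a set \<Rightarrow> 'a \<Rightarrow> bool) \<Rightarrow> 'a set \<Rightarrow> 'a set set set"
  where "F_Con CON ent X =
    {\<XX>. finite \<XX> \<and> \<XX> \<subseteq> F_tokens CON \<and> (\<XX> = {X} \<or> (\<forall>Y\<in>\<XX>. entails_set ent X Y))}"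

definition F_ent ::
    "'a set set \<Rightarrow> ('a set \<Rightarrow> 'a \<Rightarrow> bool) \<Rightarrow> 'a set \<Rightarrow> 'a set set \<Rightarrow> 'a set \<Rightarrow> bool"
  where "F_ent CON ent X \<XX> Y \<longleftrightarrow>
    X \<in> F_tokens CON \<and> \<XX> \<in> F_Con CON ent X \<and> Y \<in> F_tokens CON \<and>
    (\<exists>E\<in>\<XX> \<union> {X}. entails_set ent E Y)"

end

theory Submission
  imports Defs
begin

text \<open>By the cut axiom, \<open>F_ent CON ent X \<XX> Y\<close> does not depend on \<open>\<XX>\<close>: every \<open>E \<in> \<XX>\<close> is either
  \<open>X\<close> itself or entailed by \<open>X\<close>, so the condition amounts to \<open>X\<close> entailing \<open>Y\<close>. All frame axioms
  then reduce to transitivity of entailment between consistent sets, except interpolation, which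
  comes from interpolating each element of a finite set and consistently extending the union of
  the interpolants.\<close>

context simplified_continuous_information_system
begin

lemma entails_set_trans:
  assumes "X \<in> CON" "Y \<in> CON" "entails_set ent X Y" "entails_set ent Y Z"
  shows "entails_set ent X Z"
  using assms ent_cut unfolding entails_set_def by blast

lemma F_ent_iff:
  "F_ent CON ent X \<XX> Y \<longleftrightarrow>
    X \<in> CON \<and> \<XX> \<in> F_Con CON ent X \<and> Y \<in> CON \<and> entails_set ent X Y"
proof -
  have "entails_set ent X Y"
    if "X \<in> CON" "\<XX> \<in> F_Con CON ent X" "E \<in> \<XX> \<union> {X}" "entails_set ent E Y" for E
  proof -
    have "E = X \<or> E \<in> CON \<and> entails_set ent X E"
      using that by (auto simp: F_Con_def F_tokens_def)
    then show ?thesis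
      using that entails_set_trans by blast
  qed
  then show ?thesis
    by (auto simp: F_ent_def F_tokens_def)
qed

lemma entails_set_interpolate:
  assumes X: "X \<in> CON" and F: "finite F" "entails_set ent X F"
  shows "\<exists>Z\<in>CON. entails_set ent X Z \<and> entails_set ent Z F"
proof -
  have "\<forall>a\<in>F. \<exists>Z\<in>CON. entails_set ent X Z \<and> ent Z a"
    using X F(2) ent_interpolate by (auto simp: entails_set_def)
  then obtain g where g: "g a \<in> CON" "entails_set ent X (g a)" "ent (g a) a" if "a \<in> F" for a
    by metis
  \<comment> \<open>The union of the interpolants is not known to lie in \<open>CON\<close>. It is
    finite and entailed by \<open>X\<close>, so \<open>ent_extend\<close> yields a consistent
    superset, to which \<open>ent_mono\<close> lifts each \<open>g a\<close>.\<close>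
  have "finite (\<Union>(g ` F))" "\<Union>(g ` F) \<subseteq> S"
    using F(1) g(1) CON_finite by blast+
  moreover have "entails_set ent X (\<Union>(g ` F))"
    using g(2) by (auto simp: entails_set_def)
  ultimately obtain Z where Z: "Z \<in> CON" "\<Union>(g ` F) \<subseteq> Z" "entails_set ent X Z"
    using ent_extend[OF X] by blast
  have "ent Z a" if "a \<in> F" for a
    using ent_mono[OF g(1)[OF that] Z(1) _ g(3)[OF that]] Z(2) that by blast
  then show ?thesis
    using Z by (auto simp: entails_set_def)
qed

lemma F_interpolation:
  assumes X: "X \<in> CON" "\<XX> \<in> F_Con CON ent X"
    and Y: "finite \<YY>" "\<YY> \<subseteq> CON" "entails_set (F_ent CON ent X) \<XX> \<YY>"
  shows "\<exists>e\<in>CON. \<exists>\<ZZ>\<in>F_Con CON ent e.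
    entails_set (F_ent CON ent X) \<XX> ({e} \<union> \<ZZ>) \<and> entails_set (F_ent CON ent e) \<ZZ> \<YY>"
proof -
  \<comment> \<open>Entailing every member of \<open>\<YY>\<close> amounts to \<open>X\<close>
    entailing all tokens of their union, a finite set that can be interpolated.\<close>
  have "finite (\<Union>\<YY>)"
    using Y(1,2) CON_finite by blast
  moreover have "entails_set ent X (\<Union>\<YY>)"
    using Y(3) by (auto simp: entails_set_def[of "F_ent CON ent X"] F_ent_iff)
      (auto simp: entails_set_def)
  ultimately obtain Z where Z: "Z \<in> CON" "entails_set ent X Z" "entails_set ent Z (\<Union>\<YY>)"
    using entails_set_interpolate[OF X(1)] by blast
  \<comment> \<open>With the interpolant \<open>Z\<close> as index, the empty set suffices on the
    left: \<open>F_ent\<close> always admits the index itself as \<open>E\<close>.\<close>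
  have "{} \<in> F_Con CON ent Z"
    by (simp add: F_Con_def)
  moreover have "entails_set (F_ent CON ent X) \<XX> ({Z} \<union> {})"
    using X Z by (simp add: entails_set_def[of "F_ent CON ent X"] F_ent_iff)
  moreover have "entails_set (F_ent CON ent Z) {} \<YY>"
    using Z Y(2) \<open>{} \<in> F_Con CON ent Z\<close>
    by (auto simp: entails_set_def F_ent_iff)
  ultimately show ?thesis
    using Z(1) by blast
qed

text \<open>Unless \<open>X = Y\<close>, the index \<open>Y\<close> entails \<open>X\<close>. Cut
  then passes everything entailed by \<open>X\<close> on to \<open>Y\<close>, while
  \<open>{X}\<close> itself qualifies for \<open>Y\<close> through the second disjunct of
  \<open>F_Con\<close>.\<close>

lemma F_Con_transfer:
  assumes "X \<in> CON" "Y \<in> CON" "{X} \<in> F_Con CON ent Y"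
  shows "F_Con CON ent X \<subseteq> F_Con CON ent Y"
proof (cases "X = Y")
  case False
  then have YX: "entails_set ent Y X"
    using assms(3) by (auto simp: F_Con_def)
  have "entails_set ent Y Z" if "Z \<in> CON" "entails_set ent X Z" for Z
    using entails_set_trans[OF assms(2,1) YX that(2)] .
  then show ?thesis
    using YX by (auto simp: F_Con_def F_tokens_def)
qed simp

lemma F_ent_transfer:
  assumes "Y \<in> CON" "{X} \<in> F_Con CON ent Y" "F_ent CON ent X \<XX> Z"
  shows "F_ent CON ent Y \<XX> Z"
proof -
  have "X = Y \<or> entails_set ent Y X"
    using assms(2) by (auto simp: F_Con_def)
  then show ?thesis
    using assms F_Con_transfer[of X Y] entails_set_trans[of Y X Z] by (auto simp: F_ent_iff)
qed

end

theorem theorem4p1: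
  fixes S :: "'a set"
    and CON :: "'a set set"
    and ent :: "'a set \<Rightarrow> 'a \<Rightarrow> bool"
  assumes "simplified_continuous_information_system S CON ent"
  shows "strong_continuous_information_frame (F_tokens CON) (F_Con CON ent) (F_ent CON ent)"
proof -
  interpret simplified_continuous_information_system S CON ent
    by (fact assms)
  \<comment> \<open>The instantiation unfolds \<open>entails_set\<close> only over
    \<open>F_ent\<close>; over \<open>ent\<close> it stays folded.\<close>
  note F_entails_iff = entails_set_def[of "F_ent CON ent X" for X] F_ent_iff
  show ?thesis
    unfolding F_tokens_def
  proof (unfold_locales, goal_cases)
    case (1 X \<XX>)
    then show ?case by (simp add: F_Con_def F_tokens_def)
  next
    case (2 X \<XX> Y)
    then show ?case by (simp add: F_ent_iff)
  next
    case (3 X)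
    then show ?case by (simp add: F_Con_def F_tokens_def)
  next
    case (4 X \<XX> \<YY>)
    \<comment> \<open>A subset of \<open>{X}\<close> is \<open>{X}\<close> or empty, and the empty
      set satisfies the second disjunct vacuously.\<close>
    then show ?case
      using finite_subset[of \<YY> \<XX>] by (auto simp: F_Con_def)
  next
    case (5 X \<XX> \<YY>)
    then show ?case by (simp add: F_entails_iff) (simp add: F_Con_def F_tokens_def)
  next
    case (6 X Y \<XX> \<YY>)
    then show ?case by (simp add: F_ent_iff)
  next
    case (7 X Y \<XX> \<YY>)
    then show ?case by (simp add: F_ent_iff)
  next
    case (8 X Y)
    then show ?case using F_Con_transfer by (simp add: frame_rel_def)
  next
    case (9 X Y Z \<XX>)
    then show ?case using F_ent_transfer by (simp add: frame_rel_def)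
  next
    case (10 X \<XX> \<YY>)
    then show ?case by (rule F_interpolation)
  next
    case (11 X \<XX>)
    \<comment> \<open>Strongness: \<open>\<XX> \<noteq> {X}\<close> rules out the first disjunct of
      \<open>F_Con\<close>, and the second is the required entailment.\<close>
    then have "{X} \<in> F_Con CON ent X" "\<XX> \<subseteq> CON" "\<forall>Y\<in>\<XX>. entails_set ent X Y"
      by (auto simp: F_Con_def F_tokens_def)
    with 11 show ?case by (auto simp: F_entails_iff)
  qed
qed

end
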